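(* Let $d \ge 2$. For every $f \in \mathcal{F}_{[0,1]}$, there exists a $d$-dimensional copula $C_f$ whose copula density (with respect to Lebesgue measure on $[0,1]^d$) is the function $$c_f(\mathbf{u}) := f\Big( \Big(\sum_{j=1}^d u_j\Big) \bmod 1 \Big), \qquad \mathbf{u} = (u_1,\dots,u_d) \in [0,1]^d.$$
   Context: $\mathcal{F}_{[0,1]}$ denotes the set of probability densities on $[0,1]$ with respect to Lebesgue measure: measurable, non-negative functions on $[0,1]$ (the value $\infty$ is allowed) with $\int_0^1 f(x)\,dx = 1$. For real $x$, $x \bmod 1 := x - \lfloor x \rfloor$. A $d$-dimensional copula is a function $C:[0,1]^d\to[0,1]$ such that: (i) $C(1,\dots,1,u,1,\dots,1)=u$ for all $u\in[0,1]$ and each position of $u$; (ii) $C(\mathbf{u})=0$ whenever some coordinate of $\mathbf{u}$ is $0$; (iii) $\sum_{i_1=1}^2\cdots\sum_{i_d=1}^2(-1)^{i_1+\cdots+i_d}C(u_1^{(i_1)},\dots,u_d^{(i_d)})\ge 0$ for all $0\le u_j^{(1)}\le u_j^{(2)}\le 1$. Equivalently, $C$ is (the restriction to $[0,1]^d$ of) the joint distribution function of a random vector on $[0,1]^d$ with uniform marginals. A copula $C$ has copula density $c$ if $C(\mathbf{u})=\int_{[0,u_1]\times\cdots\times[0,u_d]}c(\mathbf{v})\,d\mathbf{v}$ for all $\mathbf{u}\in[0,1]^d$. *)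

theory Defs
  imports "HOL-Analysis.Analysis"
begin

text \<open>
  Densities are total functions of which only the values on the unit interval matter.
  Measurability is Lebesgue measurability, which includes the Borel measurable densities.
\<close>

definition unit_densities :: "(real \<Rightarrow> ennreal) set" where
  "unit_densities =
    {f \<in> borel_measurable (lebesgue_on {0..1}). (\<integral>\<^sup>+x\<in>{0..1}. f x \<partial>lebesgue) = 1}"

text \<open>
  A copula is likewise a total function of which only the values on \<open>cbox 0 1\<close> matter;
  \<open>1\<close> is the vector all of whose components are 1. In the last condition
  \<open>a\<close> and \<open>b\<close> are the lower and upper corner of the box, chosen in coordinate \<open>j\<close>
  according to \<open>i j = 1\<close> or \<open>i j = 2\<close>.
\<close>

definition copula :: "(real ^ 'n \<Rightarrow> real) \<Rightarrow> bool" where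
  "copula C \<longleftrightarrow>
    (\<forall>u \<in> cbox 0 1. C u \<in> {0..1}) \<and>
    (\<forall>k. \<forall>t \<in> {0..1}. C (\<chi> j. if j = k then t else 1) = t) \<and>
    (\<forall>u \<in> cbox 0 1. (\<exists>j. u $ j = 0) \<longrightarrow> C u = 0) \<and>
    (\<forall>a \<in> cbox 0 1. \<forall>b \<in> cbox 0 1. (\<forall>j. a $ j \<le> b $ j) \<longrightarrow>
      0 \<le> (\<Sum>i \<in> UNIV \<rightarrow> {1, 2::nat}.
             (- 1) ^ (\<Sum>j\<in>UNIV. i j) * C (\<chi> j. if i j = 1 then a $ j else b $ j)))"

text \<open>
  Since \<^const>\<open>ennreal\<close> sends negative reals to 0, the following is meant for
  functions \<open>C\<close> that are non-negative on the unit cube, as copulas are.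
  Measurability is explicit because \<^const>\<open>nn_integral\<close> is defined for all functions.
\<close>

definition has_copula_density :: "(real ^ 'n \<Rightarrow> real) \<Rightarrow> (real ^ 'n \<Rightarrow> ennreal) \<Rightarrow> bool" where
  "has_copula_density C c \<longleftrightarrow>
    c \<in> borel_measurable (lebesgue_on (cbox 0 1)) \<and>
    (\<forall>u \<in> cbox 0 1. ennreal (C u) = (\<integral>\<^sup>+v\<in>cbox 0 u. c v \<partial>lebesgue))"

end

theory Submission
  imports Defs
begin

text \<open>
  For fixed values of all coordinates but one, the fractional part of the sum of the coordinates
  is a rotation modulo 1 of the remaining coordinate, and rotations preserve Lebesgue measure
  on the unit interval. Hence, by Fubini's theorem, integrating \<open>g (frac (\<Sum>i. v $ i))\<close> over
  a box \<open>cbox 0 u\<close> that has full length in some direction \<open>j\<close> gives the integral of \<open>g\<close> over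
  \<open>{0..1}\<close> times the volume of the box (\<open>nn_integral_frac_sum_cbox\<close>). This has two uses.

  If \<open>g\<close> is a density, then the measure with density \<open>g (frac (\<Sum>i. v $ i))\<close> on the cube gives
  \<open>{v. v $ k \<le> t}\<close> the mass \<open>t\<close> for \<open>t \<in> {0..1}\<close>: a direction \<open>j \<noteq> k\<close> exists because the dimension is at
  least 2. So its marginals are uniform, and its distribution function is a copula
  (\<open>copula_measure_cbox\<close>).

  If \<open>g\<close> is the indicator function of a null set, then the integral over the cube vanishes, so
  changing a density on a null set changes the function on the cube only on a null set.
  A Lebesgue measurable density may therefore be replaced by a Borel measurable one.
\<close>

lemma nn_integral_frac_shift:
  fixes g :: "real \<Rightarrow> ennreal" and s :: real
  assumes [measurable]: "g \<in> borel_measurable borel"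
  shows "(\<integral>\<^sup>+y\<in>{0..1}. g (frac (y + s)) \<partial>lborel) = (\<integral>\<^sup>+x\<in>{0..1}. g x \<partial>lborel)"
proof -
  define a where "a = frac s"
  have a: "0 \<le> a" "a < 1"
    by (auto simp: a_def frac_lt_1)
  have frac_low: "frac (y + s) = y + a" if "0 \<le> y" "y < 1 - a" for y
    using that unfolding frac_unique_iff a_def by (auto simp: frac_def)
  have frac_high: "frac (y + s) = y + a - 1" if "1 - a \<le> y" "y < 1" for y
    using that frac_lt_1[of s] unfolding frac_unique_iff a_def by (auto simp: frac_def)
  \<comment> \<open>The sum \<open>y + a\<close> wraps around at \<open>y = 1 - a\<close>. The end point \<open>y = 1\<close>, which has
    the same image as \<open>y = 0\<close>, is a null set.\<close>
  have "(\<integral>\<^sup>+y\<in>{0..1}. g (frac (y + s)) \<partial>lborel)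
      = (\<integral>\<^sup>+y. g (y + a) * indicator {0..<1 - a} y + g (y + a - 1) * indicator {1 - a..<1} y \<partial>lborel)"
    by (rule nn_integral_cong_AE, use AE_lborel_singleton[of "1::real"] in eventually_elim)
      (use a in \<open>auto simp: indicator_def frac_low frac_high\<close>)
  also have "\<dots> = (\<integral>\<^sup>+y. g (y + a) * indicator {0..<1 - a} y \<partial>lborel)
      + (\<integral>\<^sup>+y. g (y + a - 1) * indicator {1 - a..<1} y \<partial>lborel)"
    by (rule nn_integral_add) auto
  also have "(\<integral>\<^sup>+y. g (y + a) * indicator {0..<1 - a} y \<partial>lborel)
      = (\<integral>\<^sup>+x. g x * indicator {a..<1} x \<partial>lborel)"
    by (subst nn_integral_real_affine[where c = 1 and t = a and f = "\<lambda>x. g x * indicator {a..<1} x"])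
      (auto intro!: nn_integral_cong simp: indicator_def add.commute)
  also have "(\<integral>\<^sup>+y. g (y + a - 1) * indicator {1 - a..<1} y \<partial>lborel)
      = (\<integral>\<^sup>+x. g x * indicator {0..<a} x \<partial>lborel)"
    by (subst nn_integral_real_affine[where c = 1 and t = "a - 1" and f = "\<lambda>x. g x * indicator {0..<a} x"])
      (auto intro!: nn_integral_cong simp: indicator_def algebra_simps)
  also have "(\<integral>\<^sup>+x. g x * indicator {a..<1} x \<partial>lborel) + (\<integral>\<^sup>+x. g x * indicator {0..<a} x \<partial>lborel)
      = (\<integral>\<^sup>+x. g x * indicator {a..<1} x + g x * indicator {0..<a} x \<partial>lborel)"
    by (rule nn_integral_add[symmetric]) auto
  also have "\<dots> = (\<integral>\<^sup>+x\<in>{0..1}. g x \<partial>lborel)"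
    by (rule nn_integral_cong_AE, use AE_lborel_singleton[of "1::real"] in eventually_elim)
      (use a in \<open>auto simp: indicator_def\<close>)
  finally show ?thesis .
qed

text \<open>
  Tonelli's theorem with one basis direction singled out as the inner variable. The outer
  variable \<open>x\<close> lists the coordinates with respect to the other basis vectors.
\<close>

lemma nn_integral_lborel_Basis_split:
  fixes h :: "'a::euclidean_space \<Rightarrow> ennreal"
  assumes e: "e \<in> Basis" and [measurable]: "h \<in> borel_measurable borel"
  shows "(\<integral>\<^sup>+v. h v \<partial>lborel) =
    (\<integral>\<^sup>+x. (\<integral>\<^sup>+y. h (y *\<^sub>R e + (\<Sum>b\<in>Basis - {e}. x b *\<^sub>R b)) \<partial>lborel)
      \<partial>(\<Pi>\<^sub>M b\<in>Basis - {e}. (lborel :: real measure)))"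
proof -
  interpret product_sigma_finite "\<lambda>_::'a. lborel :: real measure"
    by standard
  have B: "Basis = insert e (Basis - {e})"
    using e by auto
  have "(\<integral>\<^sup>+v. h v \<partial>lborel)
      = (\<integral>\<^sup>+x. h (\<Sum>b\<in>Basis. x b *\<^sub>R b) \<partial>(\<Pi>\<^sub>M b\<in>Basis. (lborel :: real measure)))"
    by (subst lborel_eq, subst nn_integral_distr) auto
  also have "\<dots> = (\<integral>\<^sup>+x. h (\<Sum>b\<in>Basis. x b *\<^sub>R b)
      \<partial>(\<Pi>\<^sub>M b\<in>insert e (Basis - {e}). (lborel :: real measure)))"
    using B by simp
  also have "\<dots> = (\<integral>\<^sup>+x. (\<integral>\<^sup>+y. h (\<Sum>b\<in>Basis. (x(e := y)) b *\<^sub>R b) \<partial>lborel)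
      \<partial>(\<Pi>\<^sub>M b\<in>Basis - {e}. (lborel :: real measure)))"
    by (rule product_nn_integral_insert) (use B in auto)
  also have "\<dots> = (\<integral>\<^sup>+x. (\<integral>\<^sup>+y. h (y *\<^sub>R e + (\<Sum>b\<in>Basis - {e}. x b *\<^sub>R b)) \<partial>lborel)
      \<partial>(\<Pi>\<^sub>M b\<in>Basis - {e}. (lborel :: real measure)))"
  proof -
    have "(\<Sum>b\<in>Basis. (x(e := y)) b *\<^sub>R b) = y *\<^sub>R e + (\<Sum>b\<in>Basis - {e}. x b *\<^sub>R b)" for x y
      by (subst sum.remove[OF _ e]) (auto intro!: sum.cong)
    then show ?thesis
      by simp
  qed
  finally show ?thesis .
qed

lemma borel_measurable_frac_sum [measurable]:
  "(\<lambda>v :: real^'n. frac (\<Sum>i\<in>UNIV. v $ i)) \<in> borel_measurable borel"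
  unfolding frac_def by measurable

lemma nn_integral_frac_sum_cbox:
  fixes g :: "real \<Rightarrow> ennreal" and u :: "real^'n"
  assumes [measurable]: "g \<in> borel_measurable borel" and u: "u $ j = 1"
  shows "(\<integral>\<^sup>+v\<in>cbox 0 u. g (frac (\<Sum>i\<in>UNIV. v $ i)) \<partial>lborel)
    = (\<integral>\<^sup>+x\<in>{0..1}. g x \<partial>lborel) * emeasure lborel (cbox 0 u)"
proof -
  \<comment> \<open>A point is written as \<open>y *\<^sub>R e + z x\<close>, where \<open>y\<close> is its \<open>j\<close>-th coordinate; the box is then
    the product of \<open>{0..1}\<close> for \<open>y\<close> and the condition \<open>z x \<in> R\<close> on the other coordinates.\<close>
  define e :: "real^'n" where "e = axis j 1"
  define z where "z x = (\<Sum>b\<in>Basis - {e}. x b *\<^sub>R b)" for x :: "real^'n \<Rightarrow> real"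
  define R where "R = {w. \<forall>i. i \<noteq> j \<longrightarrow> 0 \<le> w $ i \<and> w $ i \<le> u $ i}"
  let ?P = "\<Pi>\<^sub>M b\<in>Basis - {e}. (lborel :: real measure)"
  have e: "e \<in> Basis"
    by (simp add: e_def)
  have z_j: "z x $ j = 0" for x
  proof -
    have "b $ j = 0" if "b \<in> Basis - {e}" for b
      using that by (auto simp: Basis_vec_def e_def axis_def)
    then show ?thesis
      by (simp add: z_def)
  qed
  have box: "indicator (cbox 0 u) (y *\<^sub>R e + z x) = (indicator {0..1} y * indicator R (z x) :: ennreal)" for x y
  proof -
    have *: "(y *\<^sub>R e + z x) $ i = (if i = j then y else z x $ i)" for i
      using z_j by (auto simp: e_def axis_def)
    have "y *\<^sub>R e + z x \<in> cbox 0 u \<longleftrightarrow> y \<in> {0..1} \<and> z x \<in> R"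
      unfolding mem_box_cart * using u by (auto simp: R_def)
    then show ?thesis
      by (simp add: indicator_def)
  qed
  have sum_shift: "(\<Sum>i\<in>UNIV. (y *\<^sub>R e + z x) $ i) = y + (\<Sum>i\<in>UNIV. z x $ i)" for x y
    by (simp add: sum.distrib e_def axis_def sum_distrib_left[symmetric])
  have inner: "(\<integral>\<^sup>+y. h (frac (\<Sum>i\<in>UNIV. (y *\<^sub>R e + z x) $ i)) * indicator (cbox 0 u) (y *\<^sub>R e + z x) \<partial>lborel)
      = (\<integral>\<^sup>+x\<in>{0..1}. h x \<partial>lborel) * indicator R (z x)"
    if [measurable]: "h \<in> borel_measurable borel" for x and h :: "real \<Rightarrow> ennreal"
  proof -
    have [measurable]: "(\<lambda>y. frac (y + c)) \<in> borel_measurable borel" for c :: real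
      unfolding frac_def by measurable
    show ?thesis
      unfolding box sum_shift mult.assoc[symmetric]
      by (subst nn_integral_multc) (auto simp: nn_integral_frac_shift)
  qed
  have slab: "(\<integral>\<^sup>+v\<in>cbox 0 u. h (frac (\<Sum>i\<in>UNIV. v $ i)) \<partial>lborel)
      = (\<integral>\<^sup>+x. (\<integral>\<^sup>+y\<in>{0..1}. h y \<partial>lborel) * indicator R (z x) \<partial>?P)"
    if [measurable]: "h \<in> borel_measurable borel" for h :: "real \<Rightarrow> ennreal"
    using inner[OF that] by (subst nn_integral_lborel_Basis_split[OF e]) (simp_all add: z_def)
  have [measurable]: "R \<in> sets borel"
    unfolding R_def by measurable
  have [measurable]: "z \<in> borel_measurable ?P"
    unfolding z_def by measurable
  \<comment> \<open>The case of the constant function 1 identifies the outer integral as the volume.\<close>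
  have "emeasure lborel (cbox 0 u) = (\<integral>\<^sup>+x. indicator R (z x) \<partial>?P)"
    using slab[of "\<lambda>_. 1"] by simp
  then show ?thesis
    by (subst slab) (simp_all add: nn_integral_cmult)
qed

text \<open>
  The distribution function of a finite measure with uniform marginals is a copula. It is not
  assumed that the measure lives on the cube, only the mass of \<open>cbox 0 u\<close> enters. The alternating
  sum over the corners of a box is the integral of the product over \<open>j\<close> of the indicator function
  of \<open>{0..b $ j}\<close> minus that of \<open>{0..a $ j}\<close>; each factor is non-negative since \<open>a $ j \<le> b $ j\<close>.
\<close>

lemma copula_measure_cbox:
  fixes M :: "(real^'n) measure"
  assumes "finite_measure M" and [measurable_cong]: "sets M = sets borel"
    and marginal: "\<And>k t. t \<in> {0..1} \<Longrightarrow> measure M (cbox 0 (\<chi> j. if j = k then t else 1)) = t"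
  shows "copula (\<lambda>u. measure M (cbox 0 u))"
proof -
  interpret finite_measure M by fact
  have sp: "space M = UNIV"
    using sets_eq_imp_space_eq[OF assms(2)] by simp
  have le: "measure M (cbox 0 u) \<le> u $ k" if "u \<in> cbox 0 1" for u k
  proof -
    have "cbox 0 u \<subseteq> cbox 0 (\<chi> j. if j = k then u $ k else 1)"
      using that by (auto simp: mem_box_cart) (meson order_trans)
    then have "measure M (cbox 0 u) \<le> measure M (cbox 0 (\<chi> j. if j = k then u $ k else 1))"
      by (intro finite_measure_mono) auto
    then show ?thesis
      using marginal[of "u $ k" k] that by (auto simp: mem_box_cart)
  qed
  have range: "measure M (cbox 0 u) \<in> {0..1}" if "u \<in> cbox 0 1" for u
    using le[OF that] that by (auto simp: mem_box_cart) (meson order_trans)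
  have zero: "measure M (cbox 0 u) = 0" if "u \<in> cbox 0 1" "u $ j = 0" for u j
    using le[OF that(1), of j] that(2) by (simp add: measure_le_0_iff)
  have increasing: "0 \<le> (\<Sum>i \<in> UNIV \<rightarrow> {1, 2::nat}.
             (- 1) ^ (\<Sum>j\<in>UNIV. i j) * measure M (cbox 0 (\<chi> j. if i j = 1 then a $ j else b $ j)))"
    if ab: "\<And>j. a $ j \<le> b $ j" for a b
  proof -
    define w where "w i = (\<chi> j. if i j = 1 then a $ j else b $ j)" for i :: "'n \<Rightarrow> nat"
    define I where "I x j k = (indicator {0..if k = 1 then a $ j else b $ j} (x $ j) :: real)"
      for x :: "real^'n" and j and k :: nat
    have ind: "indicator (cbox 0 (w i)) x = (\<Prod>j\<in>UNIV. I x j (i j))" for i x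
      by (auto simp: indicator_def mem_box_cart w_def I_def intro!: prod.neutral)
    have "(\<Sum>i \<in> UNIV \<rightarrow> {1, 2::nat}. (- 1) ^ (\<Sum>j\<in>UNIV. i j) * measure M (cbox 0 (w i)))
        = (\<Sum>i \<in> UNIV \<rightarrow> {1, 2::nat}. \<integral>x. (- 1) ^ (\<Sum>j\<in>UNIV. i j) * indicator (cbox 0 (w i)) x \<partial>M)"
      by (simp add: sp)
    also have "\<dots> = (\<integral>x. (\<Sum>i \<in> UNIV \<rightarrow> {1, 2::nat}. (- 1) ^ (\<Sum>j\<in>UNIV. i j) * indicator (cbox 0 (w i)) x) \<partial>M)"
      by (rule Bochner_Integration.integral_sum[symmetric])
        (auto intro!: integrable_mult_right integrable_real_indicator simp: emeasure_eq_measure)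
    also have "0 \<le> \<dots>"
    proof (rule integral_nonneg_AE, rule AE_I2)
      fix x
      have "(\<Sum>i \<in> UNIV \<rightarrow> {1, 2::nat}. (- 1) ^ (\<Sum>j\<in>UNIV. i j) * indicator (cbox 0 (w i)) x)
          = (\<Sum>i \<in> PiE UNIV (\<lambda>_. {1, 2::nat}). \<Prod>j\<in>UNIV. (- 1) ^ i j * I x j (i j))"
        by (simp add: ind power_sum prod.distrib PiE_UNIV_domain)
      also have "\<dots> = (\<Prod>j\<in>UNIV. \<Sum>k\<in>{1, 2::nat}. (- 1) ^ k * I x j k)"
        by (rule prod_sum_PiE[symmetric]) auto
      also have "\<dots> \<ge> 0"
      proof (rule prod_nonneg)
        fix j
        have "(\<Sum>k\<in>{1, 2::nat}. (- 1) ^ k * I x j k) = I x j 2 - I x j 1"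
          by simp
        also have "\<dots> \<ge> 0"
          using ab[of j] by (auto simp: I_def indicator_def)
        finally show "0 \<le> (\<Sum>k\<in>{1, 2::nat}. (- 1) ^ k * I x j k)" .
      qed
      finally show "0 \<le> (\<Sum>i \<in> UNIV \<rightarrow> {1, 2::nat}. (- 1) ^ (\<Sum>j\<in>UNIV. i j) * indicator (cbox 0 (w i)) x :: real)" .
    qed
    finally show ?thesis
      by (simp add: w_def)
  qed
  show ?thesis
    unfolding copula_def using range marginal zero increasing by blast
qed

text \<open>
  By completeness of Lebesgue measure, no measurability of \<open>c\<close> itself has to be assumed.
\<close>

lemma borel_measurable_lebesgue_AE_eq:
  fixes c c' :: "'a::euclidean_space \<Rightarrow> ennreal"
  assumes c': "c' \<in> borel_measurable borel" and ae: "AE v in lborel. c v = c' v"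
  shows "c \<in> borel_measurable lebesgue"
proof (rule measurableI)
  fix A :: "ennreal set" assume A: "A \<in> sets borel"
  have "c' -` A \<inter> space lebesgue \<in> sets lebesgue"
    using c' A by (intro measurable_sets[of c' lebesgue borel] measurable_completion) auto
  then show "c -` A \<inter> space lebesgue \<in> sets lebesgue"
    by (rule completion.in_sets_AE[rotated])
      (use AE_completion[OF ae] in \<open>auto elim: eventually_mono\<close>)
qed auto

theorem proposition1:
  fixes f :: "real \<Rightarrow> ennreal"
  assumes "CARD('n::finite) \<ge> 2"
    and "f \<in> unit_densities"
  shows "\<exists>C :: real ^ 'n \<Rightarrow> real.
    copula C \<and> has_copula_density C (\<lambda>u. f (frac (\<Sum>j\<in>UNIV. u $ j)))"
proof -
  let ?s = "\<lambda>v :: real^'n. frac (\<Sum>j\<in>UNIV. v $ j)"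
  have box_subset: "cbox 0 u \<subseteq> cbox 0 1" if "u \<in> cbox 0 1" for u :: "real^'n"
    using that by (auto simp: mem_box_cart) (meson order_trans)
  have f_meas: "f \<in> borel_measurable (lebesgue_on {0..1})"
    and f_int: "(\<integral>\<^sup>+x\<in>{0..1}. f x \<partial>lebesgue) = 1"
    using assms(2) by (auto simp: unit_densities_def)
  have "(\<lambda>x. f x * indicator {0..1} x) \<in> borel_measurable lebesgue"
    using f_meas by (simp add: borel_measurable_restrict_space_iff_ennreal)
  \<comment> \<open>\<open>g\<close> is a Borel measurable version of \<open>f\<close>, vanishing almost everywhere outside \<open>{0..1}\<close>.\<close>
  then obtain g where g [measurable]: "g \<in> borel_measurable borel"
    and fg: "AE x in lborel. f x * indicator {0..1} x = g x"
    using completion_ex_borel_measurable[of _ lborel] by auto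
  have g_int: "(\<integral>\<^sup>+x\<in>{0..1}. g x \<partial>lborel) = 1"
  proof -
    have "(\<integral>\<^sup>+x\<in>{0..1}. g x \<partial>lborel) = (\<integral>\<^sup>+x\<in>{0..1}. f x \<partial>lborel)"
      by (rule nn_integral_cong_AE, use fg in eventually_elim) (auto simp: indicator_def)
    then show ?thesis
      using f_int by (simp add: nn_integral_completion)
  qed
  have ae: "AE v in lborel. f (?s v) * indicator (cbox 0 1) v = g (?s v) * indicator (cbox 0 1) v"
  proof -
    obtain N where N: "N \<in> null_sets lborel" and sub: "{x. f x * indicator {0..1} x \<noteq> g x} \<subseteq> N"
      using fg by (auto simp: eventually_ae_filter)
    then have [measurable]: "N \<in> sets borel"
      by auto
    have "(\<integral>\<^sup>+x\<in>{0..1}. indicator N x \<partial>lborel) = 0"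
      using AE_not_in[OF N] by (subst nn_integral_0_iff_AE) (auto elim: eventually_mono)
    then have "(\<integral>\<^sup>+v\<in>cbox 0 (1 :: real^'n). indicator N (?s v) \<partial>lborel) = 0"
      by (subst nn_integral_frac_sum_cbox) auto
    then have "AE v in lborel. indicator N (?s v) * indicator (cbox 0 1) v = (0 :: ennreal)"
      by (subst (asm) nn_integral_0_iff_AE) auto
    then show ?thesis
    proof eventually_elim
      fix v :: "real^'n"
      assume v: "indicator N (?s v) * indicator (cbox 0 1) v = (0 :: ennreal)"
      have "?s v \<in> {0..1}"
        by (auto intro: less_imp_le frac_lt_1)
      then show "f (?s v) * indicator (cbox 0 1) v = g (?s v) * indicator (cbox 0 1) v"
      proof (cases "v \<in> cbox 0 1")
        case True
        then have "?s v \<notin> N"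
          using v by (auto simp: indicator_def)
        then have "f (?s v) * indicator {0..1} (?s v) = g (?s v)"
          using sub by blast
        then show ?thesis
          using \<open>?s v \<in> {0..1}\<close> by simp
      qed simp
    qed
  qed
  define M where "M = density lborel (\<lambda>v :: real^'n. g (?s v) * indicator (cbox 0 1) v)"
  have sets_M: "sets M = sets borel"
    by (simp add: M_def)
  have M_box: "emeasure M (cbox 0 u) = (\<integral>\<^sup>+v\<in>cbox 0 u. g (?s v) \<partial>lborel)" if "u \<in> cbox 0 1" for u
    unfolding M_def using box_subset[OF that]
    by (subst emeasure_density) (auto intro!: nn_integral_cong simp: indicator_def)
  have "emeasure lborel (cbox 0 (1 :: real^'n)) = 1"
    by (subst emeasure_lborel_cbox) (auto simp: Basis_vec_def inner_axis intro!: prod.neutral)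
  then have M_space: "emeasure M (space M) = 1"
    by (simp add: M_def emeasure_density nn_integral_frac_sum_cbox g_int)
  interpret finite_measure M
    by standard (simp add: M_space)
  have marginal: "measure M (cbox 0 (\<chi> j. if j = k then t else 1)) = t"
    if t: "t \<in> {0..1}" for k :: 'n and t
  proof -
    let ?u = "\<chi> j. if j = k then t else 1"
    \<comment> \<open>The box has full length in every direction other than \<open>k\<close>.\<close>
    obtain j where j: "j \<noteq> k"
    proof -
      have "CARD('n) \<noteq> card {k}"
        using assms(1) by simp
      then have "(UNIV :: 'n set) \<noteq> {k}"
        by metis
      then show ?thesis
        using that by auto
    qed
    have "emeasure M (cbox 0 ?u) = emeasure lborel (cbox 0 ?u)"
      using t j by (subst M_box)
        (auto simp: mem_box_cart nn_integral_frac_sum_cbox[where j = j] g_int)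
    then have "measure M (cbox 0 ?u) = measure lborel (cbox 0 ?u)"
      by (simp add: measure_def)
    also have "\<dots> = (\<Prod>i\<in>UNIV. if i = k then t else 1)"
      using t by (subst content_cbox_cart) (auto simp: interval_eq_empty_cart intro!: prod.cong)
    finally show ?thesis
      by simp
  qed
  have "has_copula_density (\<lambda>u. measure M (cbox 0 u)) (\<lambda>u. f (?s u))"
    unfolding has_copula_density_def
  proof (intro conjI ballI)
    show "(\<lambda>u. f (?s u)) \<in> borel_measurable (lebesgue_on (cbox 0 1))"
      using borel_measurable_lebesgue_AE_eq[OF _ ae]
      by (simp add: borel_measurable_restrict_space_iff_ennreal)
    fix u :: "real^'n" assume u: "u \<in> cbox 0 1"
    have "ennreal (measure M (cbox 0 u)) = (\<integral>\<^sup>+v\<in>cbox 0 u. g (?s v) \<partial>lborel)"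
      using M_box[OF u] by (simp add: emeasure_eq_measure)
    also have "\<dots> = (\<integral>\<^sup>+v\<in>cbox 0 u. f (?s v) \<partial>lborel)"
      by (rule nn_integral_cong_AE, use ae in eventually_elim)
        (use box_subset[OF u] in \<open>auto simp: indicator_def split: if_splits\<close>)
    finally show "ennreal (measure M (cbox 0 u)) = (\<integral>\<^sup>+v\<in>cbox 0 u. f (?s v) \<partial>lebesgue)"
      by (simp add: nn_integral_completion)
  qed
  then show ?thesis
    using copula_measure_cbox[OF finite_measure_axioms sets_M marginal] by blast
qed

end
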